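(* Let $v=(v_1,\ldots,v_n)\in\mathbb{R}^n$ be such that $v_i>(6n^2+1)v_{i+1}$ for all $i\in\{1,\ldots,n-1\}$ and $v_n>0$. Let $G=([n],E)$ be a graph, let $R$ be a region of the graphical arrangement $\mathcal{A}_G$, and suppose that the acyclic orientation $\gamma_R$ of $G$ has $k$ source components. Then $\mathrm{pd}_v(R)=k$, that is, the projection dimension of $v$ on $R$ equals the number of source components of $\gamma_R$. Moreover, the face of $R$ containing $\mathrm{proj}_v(R)$ in its relative interior is $F_{\Pi(\gamma_R)}$.
   Context: $[n]=\{1,\ldots,n\}$. Graphs are finite, undirected, without loops or multiple edges. The graphical arrangement $\mathcal{A}_G$ is the collection of hyperplanes $\{x\in\mathbb{R}^n: x_i=x_j\}$ for $\{i,j\}\in E$. Regions are taken closed (closures of connected components of the complement of the hyperplanes). For a region $R$ of $\mathcal{A}_G$, $\gamma_R$ is the acyclic orientation of $G$ in which the edge $\{i,j\}\in E$ is directed towards $i$ if and only if $x_i\ge x_j$ for all $x \in R$. For a region $R$ and $v\in\mathbb{R}^n$, $\mathrm{proj}_v(R)$ is the unique point of $R$ at minimum Euclidean distance from $v$, and $\mathrm{pd}_v(R)$ is the dimension of the unique face of $R$ that contains $\mathrm{proj}_v(R)$ in its relative interior. Source components: let $\gamma$ be an acyclic orientation of $G$. For $i\in[n]$ let $R_i$ be the set of vertices reachable from $i$ by a directed path of $\gamma$ (with $i\in R_i$). Define $S_1,S_2,\ldots$ recursively: if $\bigcup_{i<k}S_i=[n]$ then $S_k=\emptyset$; otherwise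 $S_k=R_m\setminus\bigcup_{i<k}S_i$ where $m=\min([n]\setminus\bigcup_{i<k}S_i)$. The non-empty sets $S_k$ are the source components of $\gamma$. They form an ordered partition $\Pi(\gamma)=(S_1,\ldots,S_k)$ of $[n]$. For an ordered partition $\Pi=(B_1,\ldots,B_k)$ of $[n]$, $F_\Pi$ denotes the face of $\mathcal{A}_G$ whose relative interior contains all points $x$ such that $x_i=x_j$ whenever $i,j$ are in the same block and $x_i>x_j$ whenever the block of $i$ comes before the block of $j$. *)

theory Defs
  imports "HOL-Analysis.Analysis"
begin

text \<open>
  Throughout, the index set \<open>[n] = {1, \<dots>, n}\<close> is rendered as an arbitrary finite linearly ordered
  type \<^typ>\<open>'n\<close> with \<open>n = CARD('n)\<close>; the successor \<open>i + 1\<close> of an index is its immediate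
  successor in the order, and the last index \<open>n\<close> is \<open>Max UNIV\<close>.
\<close>

definition simple_graph :: "'n set set \<Rightarrow> bool" where
  "simple_graph E \<longleftrightarrow> (\<forall>e\<in>E. card e = 2)"

definition graphical_arrangement :: "'n::finite set set \<Rightarrow> (real^'n) set set" where
  "graphical_arrangement E = {{x. x $ i = x $ j} | i j. {i, j} \<in> E}"

definition region :: "(real^'n::finite) set set \<Rightarrow> (real^'n) set \<Rightarrow> bool" where
  "region \<A> R \<longleftrightarrow> (\<exists>C \<in> components (- \<Union>\<A>). R = closure C)"

text \<open>
  The library's \<^const>\<open>face_of\<close> also admits the empty set as a face, which is excluded here.
\<close>

definition arrangement_face :: "(real^'n::finite) set set \<Rightarrow> (real^'n) set \<Rightarrow> bool" where
  "arrangement_face \<A> F \<longleftrightarrow> F \<noteq> {} \<and> (\<exists>R. region \<A> R \<and> F face_of R)"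

definition proj_point :: "real^'n \<Rightarrow> (real^'n) set \<Rightarrow> real^'n::finite" where
  "proj_point v R = closest_point R v"

definition proj_face :: "real^'n \<Rightarrow> (real^'n) set \<Rightarrow> (real^'n::finite) set" where
  "proj_face v R = (THE F. F face_of R \<and> proj_point v R \<in> rel_interior F)"

definition proj_dim :: "real^'n \<Rightarrow> (real^'n::finite) set \<Rightarrow> int" where
  "proj_dim v R = aff_dim (proj_face v R)"

text \<open>
  An orientation is the set of its arcs: \<open>(j, i)\<close> is the edge \<open>{i, j}\<close> directed towards \<open>i\<close>.
\<close>

definition region_orientation :: "'n set set \<Rightarrow> (real^'n::finite) set \<Rightarrow> 'n rel" where
  "region_orientation E R = {(j, i). {i, j} \<in> E \<and> (\<forall>x\<in>R. x $ i \<ge> x $ j)}"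

text \<open>
  The recursion is indexed from 0, so \<open>source_set \<gamma> k\<close> is the set usually written \<open>S\<^sub>k\<^sub>+\<^sub>1\<close>.
\<close>

context
  notes image_cong [fundef_cong]
begin

fun source_set :: "'n::{finite,linorder} rel \<Rightarrow> nat \<Rightarrow> 'n set" where
  "source_set \<gamma> k =
     (let U = (\<Union>i\<in>{..<k}. source_set \<gamma> i) in
      if U = UNIV then {} else \<gamma>\<^sup>* `` {Min (UNIV - U)} - U)"

end

declare source_set.simps [simp del]

definition source_components :: "'n::{finite,linorder} rel \<Rightarrow> 'n set set" where
  "source_components \<gamma> = {source_set \<gamma> k | k. source_set \<gamma> k \<noteq> {}}"

text \<open>
  Ordered partitions are lists of blocks. The non-empty source sets are pairwise disjoint and
  form an initial segment of the sequence.
\<close>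

definition source_partition :: "'n::{finite,linorder} rel \<Rightarrow> 'n set list" where
  "source_partition \<gamma> = map (source_set \<gamma>) [0..<card (source_components \<gamma>)]"

definition partition_points :: "'n set list \<Rightarrow> (real^'n::finite) set" where
  "partition_points Bs = {x.
     (\<forall>B\<in>set Bs. \<forall>i\<in>B. \<forall>j\<in>B. x $ i = x $ j) \<and>
     (\<forall>a b. a < b \<and> b < length Bs \<longrightarrow> (\<forall>i\<in>Bs ! a. \<forall>j\<in>Bs ! b. x $ i > x $ j))}"

definition partition_face :: "'n set set \<Rightarrow> 'n set list \<Rightarrow> (real^'n::finite) set" where
  "partition_face E Bs =
     (THE F. arrangement_face (graphical_arrangement E) F \<and> partition_points Bs \<subseteq> rel_interior F)"

end

theory Submission
  imports Defs
begin

text \<open>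
  A region is the cone \<open>x\<^sub>j \<le> x\<^sub>i\<close> over the arcs \<open>(j, i)\<close> of its orientation, so projecting \<open>v\<close> onto it
  is isotonic regression. Replacing \<open>v\<close> by its averages over the source components gives the
  projection \<open>p\<close>: each component has a least element from which all of it is reachable, the entry
  of \<open>v\<close> there dominates the others, and the variational inequality can be checked one component
  at a time. The averages decrease strictly along the components, and the face containing \<open>p\<close> in its
  relative interior is determined by the signs of \<open>p\<^sub>i - p\<^sub>j\<close> on the edges.
\<close>

section \<open>Regions as order cones\<close>

definition order_cone :: "'n rel \<Rightarrow> (real^'n::finite) set" where
  "order_cone \<gamma> = {x. \<forall>(j, i)\<in>\<gamma>. x $ j \<le> x $ i}"

text \<open>A tie of \<open>p\<close> on an edge applies in both orders and so forces a tie of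
  \<open>x\<close>; a strict comparison is relaxed to a weak one. The result is the face of the
  arrangement with \<open>p\<close> in its relative interior, written without reference to a
  region.\<close>

definition cell :: "'n set set \<Rightarrow> real^'n \<Rightarrow> (real^'n::finite) set" where
  "cell E p = {x. \<forall>i j. {i, j} \<in> E \<and> p $ j \<le> p $ i \<longrightarrow> x $ j \<le> x $ i}"

lemma order_cone_rtrancl:
  assumes "x \<in> order_cone \<gamma>" "(j, i) \<in> \<gamma>\<^sup>*"
  shows "x $ j \<le> x $ i"
  using assms(2)
proof induction
  case (step y z)
  then have "x $ y \<le> x $ z" using assms(1) by (auto simp: order_cone_def)
  with step show ?case by simp
qed simp

lemma convex_order_cone: "convex (order_cone \<gamma>)"
proof -
  have "order_cone \<gamma> = (\<Inter>(j, i)\<in>\<gamma>. {x. (axis j 1 - axis i 1) \<bullet> x \<le> 0})"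
    by (auto simp: order_cone_def inner_diff_left inner_axis')
  then show ?thesis by (auto intro!: convex_INT convex_halfspace_le)
qed

lemma closed_order_cone: "closed (order_cone \<gamma>)"
proof -
  have "order_cone \<gamma> = (\<Inter>(j, i)\<in>\<gamma>. {x. (axis j 1 - axis i 1) \<bullet> x \<le> 0})"
    by (auto simp: order_cone_def inner_diff_left inner_axis')
  then show ?thesis by (auto intro!: closed_INT closed_halfspace_le)
qed

text \<open>The open cone cut out by the signs of a point \<open>c\<close> of the component is
  convex, hence connected, and misses every hyperplane, so it lies in the component. Conversely, a
  point of the component with another sign would, by the intermediate value property, give a point
  of it on a hyperplane. The second claim holds because \<open>c\<close> has no ties on
  edges.\<close>

lemma region_eq_order_cone:
  fixes E :: "'n::finite set set"
  assumes "region (graphical_arrangement E) R"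
  shows "R = order_cone (region_orientation E R)"
    and "\<And>i j. {i, j} \<in> E \<Longrightarrow> (i, j) \<in> region_orientation E R \<or> (j, i) \<in> region_orientation E R"
proof -
  let ?A = "- \<Union>(graphical_arrangement E)"
  obtain C where C: "C \<in> components ?A" and R: "R = closure C"
    using assms by (auto simp: region_def)
  from C obtain c where c: "c \<in> C" using in_components_nonempty by blast
  have CA: "C \<subseteq> ?A" using C in_components_subset by blast
  have neq: "x $ i \<noteq> x $ j" if "x \<in> C" "{i, j} \<in> E" for x i j
    using CA that by (auto simp: graphical_arrangement_def)
  define \<gamma> where "\<gamma> = {(j, i). {i, j} \<in> E \<and> c $ j < c $ i}"
  define U where "U = {x::real^'n. \<forall>(j, i)\<in>\<gamma>. x $ j < x $ i}"
  have U_Inter: "U = (\<Inter>(j, i)\<in>\<gamma>. {x. (axis j 1 - axis i 1) \<bullet> x < 0})"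
    by (auto simp: U_def inner_diff_left inner_axis')
  have cU: "c \<in> U" by (auto simp: U_def \<gamma>_def)
  have "convex U" unfolding U_Inter by (auto intro!: convex_INT convex_halfspace_lt)
  then have conn: "connected U" by (rule convex_connected)
  have UA: "U \<subseteq> ?A"
  proof
    fix x assume x: "x \<in> U"
    have "x $ i \<noteq> x $ j" if e: "{i, j} \<in> E" for i j
    proof -
      have "(i, j) \<in> \<gamma> \<or> (j, i) \<in> \<gamma>"
        using neq[OF c e] e by (auto simp: \<gamma>_def insert_commute)
      then show ?thesis using x by (auto simp: U_def)
    qed
    then show "x \<in> ?A" by (auto simp: graphical_arrangement_def)
  qed
  have "U \<subseteq> C"
    using components_maximal[OF C conn UA] c cU by blast
  moreover have "C \<subseteq> U"
  proof
    fix x assume x: "x \<in> C"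
    have "x $ j < x $ i" if ji: "(j, i) \<in> \<gamma>" for i j
    proof (rule ccontr)
      assume "\<not> x $ j < x $ i"
      then have "0 \<le> (axis j 1 - axis i 1) \<bullet> x" by (simp add: inner_diff_left inner_axis')
      moreover have "(axis j 1 - axis i 1) \<bullet> c \<le> 0"
        using ji by (simp add: \<gamma>_def inner_diff_left inner_axis')
      moreover have "connected C" using C in_components_connected by blast
      ultimately obtain z where "z \<in> C" "(axis j 1 - axis i 1) \<bullet> z = 0"
        using connected_ivt_hyperplane[OF _ c x] by blast
      then show False
        using neq[of z i j] ji by (auto simp: \<gamma>_def inner_diff_left inner_axis')
    qed
    then show "x \<in> U" by (auto simp: U_def)
  qed
  ultimately have CU: "C = U" by blast
  have clU: "closure U = order_cone \<gamma>"
  proof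
    show "closure U \<subseteq> order_cone \<gamma>"
      by (rule closure_minimal[OF _ closed_order_cone])
        (auto simp: U_def order_cone_def intro: less_imp_le)
    show "order_cone \<gamma> \<subseteq> closure U"
    proof
      fix x assume x: "x \<in> order_cone \<gamma>"
      \<comment> \<open>Adding a small positive multiple of \<open>c\<close> makes every weak
        inequality of \<open>x\<close> strict, so \<open>x\<close> is a limit of points of
        \<open>U\<close>.\<close>
      have lim: "(\<lambda>n. x + (1 / real (Suc n)) *\<^sub>R c) \<longlonglongrightarrow> x + 0 *\<^sub>R c"
        by (intro tendsto_intros LIMSEQ_Suc[OF lim_1_over_n])
      have "x + (1 / real (Suc n)) *\<^sub>R c \<in> U" for n
        using x cU
        by (auto simp: U_def order_cone_def intro!: add_le_less_mono divide_strict_right_mono)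
      then show "x \<in> closure U"
        using lim unfolding closure_sequential
        by (intro exI[of _ "\<lambda>n. x + (1 / real (Suc n)) *\<^sub>R c"]) auto
    qed
  qed
  have RK: "R = order_cone \<gamma>" using R CU clU by simp
  have cR: "c \<in> R" using c R closure_subset by blast
  \<comment> \<open>An arc must weakly increase on all of \<open>R\<close>, in particular at
    \<open>c\<close>, where no edge is tied; this leaves only the direction recorded in
    \<open>\<gamma>\<close>.\<close>
  have "region_orientation E R = \<gamma>"
  proof
    show "region_orientation E R \<subseteq> \<gamma>"
      using cR neq[OF c] by (fastforce simp: region_orientation_def \<gamma>_def order.strict_iff_order)
    show "\<gamma> \<subseteq> region_orientation E R"
      unfolding RK by (auto simp: region_orientation_def order_cone_def \<gamma>_def)
  qed
  with RK show "R = order_cone (region_orientation E R)" by simp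
  show "(i, j) \<in> region_orientation E R \<or> (j, i) \<in> region_orientation E R" if e: "{i, j} \<in> E" for i j
    using neq[OF c e] e \<open>region_orientation E R = \<gamma>\<close> by (auto simp: \<gamma>_def insert_commute)
qed

section \<open>Faces of a region as cells\<close>

lemma mem_cell_self: "p \<in> cell E p"
  by (simp add: cell_def)

text \<open>Each comparison in \<open>cell E p\<close> either follows an arc and holds on all of
  \<open>R\<close>, or opposes an arc and asks for equality in an inequality valid on
  \<open>R\<close>. Equality in a valid inequality cuts out a face.\<close>

lemma cell_face_of_region:
  assumes "region (graphical_arrangement E) R" "p \<in> R"
  shows "cell E p face_of R"
proof -
  let ?\<gamma> = "region_orientation E R"
  note K = region_eq_order_cone(1)[OF assms(1)] and tot = region_eq_order_cone(2)[OF assms(1)]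
  have sub: "{i, j} \<in> E" if "(j, i) \<in> ?\<gamma>" for i j
    using that by (auto simp: region_orientation_def)
  have le: "x $ j \<le> x $ i" if "x \<in> R" "(j, i) \<in> ?\<gamma>" for x i j
    using that by (auto simp: region_orientation_def)
  have cR: "cell E p \<subseteq> R"
  proof
    fix x assume "x \<in> cell E p"
    then have "x \<in> order_cone ?\<gamma>"
      using sub le[OF assms(2)] by (auto simp: cell_def order_cone_def)
    with K show "x \<in> R" by simp
  qed
  have "convex (cell E p)"
  proof -
    have "cell E p = order_cone {(j, i). {i, j} \<in> E \<and> p $ j \<le> p $ i}"
      by (auto simp: cell_def order_cone_def)
    then show ?thesis by (simp add: convex_order_cone)
  qed
  moreover have "a \<in> cell E p \<and> b \<in> cell E p"
    if a: "a \<in> R" and b: "b \<in> R" and x: "x \<in> cell E p" and seg: "x \<in> open_segment a b" for a b x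
  proof -
    obtain u where u: "0 < u" "u < 1" "x = (1 - u) *\<^sub>R a + u *\<^sub>R b"
      using seg by (auto simp: in_segment)
    have "a $ j \<le> a $ i \<and> b $ j \<le> b $ i" if e: "{i, j} \<in> E" and ji: "p $ j \<le> p $ i" for i j
    proof (cases "(j, i) \<in> ?\<gamma>")
      case True
      then show ?thesis using le a b by blast
    next
      case False
      then have ij: "(i, j) \<in> ?\<gamma>" using tot[OF e] by blast
      have "x $ j \<le> x $ i" using x e ji by (auto simp: cell_def)
      \<comment> \<open>Both differences are nonnegative because the arc runs the other way, and
        both weights are positive, so a nonpositive combination makes each difference
        vanish.\<close>
      then have "(1 - u) * (a $ j - a $ i) + u * (b $ j - b $ i) \<le> 0"
        using u(3) by (simp add: algebra_simps)
      moreover have "0 \<le> a $ j - a $ i" "0 \<le> b $ j - b $ i" using le[OF a ij] le[OF b ij] by auto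
      ultimately have "(1 - u) * (a $ j - a $ i) = 0 \<and> u * (b $ j - b $ i) = 0"
        using u by (smt (verit) mult_nonneg_nonneg)
      then show ?thesis using u by simp
    qed
    then show ?thesis by (auto simp: cell_def)
  qed
  ultimately show ?thesis using cR unfolding face_of_def by blast
qed

text \<open>\<open>L\<close> keeps the ties of \<open>p\<close> on edges, \<open>T\<close> its
  strict comparisons. \<open>T\<close> is open and contains \<open>p\<close>, and
  \<open>T \<inter> L\<close> lies in the cell, which lies in \<open>L\<close>; so the cell is a
  neighbourhood of \<open>p\<close> within the subspace \<open>L\<close> and has its
  dimension.\<close>

lemma cell_aff:
  fixes p :: "real^'n::finite" and E :: "'n set set"
  defines "L \<equiv> {x::real^'n. \<forall>i j. {i, j} \<in> E \<and> p $ i = p $ j \<longrightarrow> x $ i = x $ j}"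
  shows "p \<in> rel_interior (cell E p)" and "aff_dim (cell E p) = int (dim L)"
proof -
  define D where "D = {(j, i). {i, j} \<in> E \<and> p $ j < p $ i}"
  define T where "T = (\<Inter>(j, i)\<in>D. {x::real^'n. (axis j 1 - axis i 1) \<bullet> x < 0})"
  have T: "x \<in> T \<longleftrightarrow> (\<forall>(j, i)\<in>D. x $ j < x $ i)" for x
    by (auto simp: T_def inner_diff_left inner_axis')
  have "open T" unfolding T_def by (intro open_INT) (auto intro: open_halfspace_lt)
  have pT: "p \<in> T" by (auto simp: T D_def)
  have pL: "p \<in> L" by (auto simp: L_def)
  have "subspace L"
    unfolding subspace_def L_def by auto
  have TL: "T \<inter> L \<subseteq> cell E p"
  proof
    fix x assume x: "x \<in> T \<inter> L"
    have "x $ j \<le> x $ i" if "{i, j} \<in> E" "p $ j \<le> p $ i" for i j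
    proof (cases "p $ i = p $ j")
      case True
      then show ?thesis using x that by (auto simp: L_def)
    next
      case False
      then have "x $ j < x $ i" using x that by (auto simp: T D_def)
      then show ?thesis by simp
    qed
    then show "x \<in> cell E p" by (simp add: cell_def)
  qed
  have cL: "cell E p \<subseteq> L"
    unfolding cell_def L_def by (auto intro!: antisym simp: insert_commute)
  have "affine L" using \<open>subspace L\<close> by (rule subspace_imp_affine)
  then have hull: "affine hull cell E p \<subseteq> L" by (rule hull_minimal[OF cL])
  show "p \<in> rel_interior (cell E p)"
    unfolding mem_rel_interior using \<open>open T\<close> pT hull TL mem_cell_self[of p E] by blast
  have "aff_dim (T \<inter> L) = aff_dim L"
    using \<open>open T\<close> \<open>affine L\<close> pT pL
    by (intro aff_dim_openin) (auto simp: hull_same openin_open_Int Int_commute)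
  then have "aff_dim (cell E p) = aff_dim L"
    using aff_dim_subset[OF TL] aff_dim_subset[OF cL] by simp
  also have "\<dots> = int (dim L)"
    using \<open>subspace L\<close> by (rule aff_dim_subspace)
  finally show "aff_dim (cell E p) = int (dim L)" .
qed

text \<open>Faces of a convex set whose relative interiors meet are equal. As the cell does not
  mention \<open>R\<close>, this also identifies faces taken from different regions.\<close>

lemma region_face_eq_cell:
  assumes "region (graphical_arrangement E) R" "F face_of R" "p \<in> rel_interior F"
  shows "F = cell E p"
proof -
  have "p \<in> R" using assms rel_interior_subset face_of_imp_subset by blast
  then show ?thesis
    using face_of_eq[OF assms(2) cell_face_of_region[OF assms(1)]] cell_aff(1) assms(3) by blast
qed

section \<open>Dimension of the space of blockwise constant vectors\<close>

text \<open>The indicator vectors of the blocks form a basis: disjointness makes them orthogonal,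
  nonemptiness makes them nonzero, and they span because the blocks cover the index set.\<close>

lemma dim_partition_constant:
  fixes P :: "'n::finite set set"
  assumes "partition_on UNIV P"
  shows "dim {x::real^'n. \<forall>B\<in>P. \<forall>i\<in>B. \<forall>j\<in>B. x $ i = x $ j} = card P"
proof -
  let ?L = "{x::real^'n. \<forall>B\<in>P. \<forall>i\<in>B. \<forall>j\<in>B. x $ i = x $ j}"
  define b :: "'n set \<Rightarrow> real^'n" where "b B = (\<chi> i. if i \<in> B then 1 else 0)" for B
  have inj: "inj b"
    by (rule injI) (auto simp: b_def vec_eq_iff split: if_splits)
  have ne: "B \<noteq> {}" if "B \<in> P" for B using assms that by (auto simp: partition_on_def)
  have dis: "B = B'" if "B \<in> P" "B' \<in> P" "i \<in> B" "i \<in> B'" for B B' i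
    using assms that by (auto simp: partition_on_def disjoint_def)
  have "b ` P \<subseteq> ?L"
  proof (intro image_subsetI CollectI ballI)
    fix B' B i j assume "B' \<in> P" "B \<in> P" "i \<in> B" "j \<in> B"
    then have "i \<in> B' \<longleftrightarrow> j \<in> B'" using dis[of B B'] by metis
    then show "b B' $ i = b B' $ j" by (simp add: b_def)
  qed
  moreover have "?L \<subseteq> span (b ` P)"
  proof
    fix x assume x: "x \<in> ?L"
    \<comment> \<open>The coefficient of a block is the common value of \<open>x\<close> on it, read
      off at an arbitrary representative.\<close>
    have "x = (\<Sum>B\<in>P. (x $ (SOME i. i \<in> B)) *\<^sub>R b B)"
    proof (subst vec_eq_iff, rule allI)
      fix i
      have "i \<in> \<Union>P" using assms by (simp add: partition_on_def)
      then obtain B where B: "B \<in> P" "i \<in> B" by blast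
      have "(SOME i. i \<in> B) \<in> B" using B by (metis someI)
      then have "x $ i = x $ (SOME i. i \<in> B)" using x B by blast
      also have "\<dots> = (\<Sum>B'\<in>P. if B' = B then x $ (SOME i. i \<in> B') else 0)"
        using B by simp
      also have "\<dots> = (\<Sum>B'\<in>P. x $ (SOME i. i \<in> B') * (if i \<in> B' then 1 else 0))"
        using B by (intro sum.cong) (auto dest: dis[OF _ B(1) _ B(2)])
      finally show "x $ i = (\<Sum>B\<in>P. (x $ (SOME i. i \<in> B)) *\<^sub>R b B) $ i"
        by (simp add: b_def)
    qed
    also have "\<dots> \<in> span (b ` P)"
      by (intro span_sum span_scale span_base) auto
    finally show "x \<in> span (b ` P)" .
  qed
  moreover have "independent (b ` P)"
  proof (rule pairwise_orthogonal_independent)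
    show "pairwise orthogonal (b ` P)"
    proof (rule pairwiseI)
      fix x y assume "x \<in> b ` P" "y \<in> b ` P" "x \<noteq> y"
      then obtain B B' where B: "B \<in> P" "B' \<in> P" "B \<noteq> B'" "x = b B" "y = b B'" by blast
      then have "x $ i * y $ i = 0" for i using dis[of B B' i] by (auto simp: b_def)
      then have "(\<Sum>i\<in>UNIV. x $ i * y $ i) = 0" by (intro sum.neutral) blast
      then show "orthogonal x y" by (simp add: orthogonal_def inner_vec_def)
    qed
    show "0 \<notin> b ` P"
    proof
      assume "0 \<in> b ` P"
      then obtain B where B: "0 = b B" "B \<in> P" by (rule imageE)
      from ne[OF this(2)] obtain i where "i \<in> B" by blast
      then have "b B $ i = 1" by (simp add: b_def)
      with B(1)[symmetric] show False by simp
    qed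
  qed
  moreover have "card (b ` P) = card P"
    using inj by (meson card_image inj_on_subset subset_UNIV)
  ultimately show ?thesis by (rule dim_unique)
qed

section \<open>The recursion for source components\<close>

definition reached :: "'n::{finite,linorder} rel \<Rightarrow> nat \<Rightarrow> 'n set" where
  "reached \<gamma> k = (\<Union>i<k. source_set \<gamma> i)"

lemma source_set_reached:
  "source_set \<gamma> k =
    (if reached \<gamma> k = UNIV then {} else \<gamma>\<^sup>* `` {Min (UNIV - reached \<gamma> k)} - reached \<gamma> k)"
  by (subst source_set.simps) (simp add: reached_def Let_def)

lemma reached_Suc: "reached \<gamma> (Suc k) = reached \<gamma> k \<union> source_set \<gamma> k"
  by (auto simp: reached_def lessThan_Suc)

lemma reached_mono: "k \<le> l \<Longrightarrow> reached \<gamma> k \<subseteq> reached \<gamma> l"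
  by (auto simp: reached_def) (meson lessThan_iff order_less_le_trans)

text \<open>Subtracting the earlier sets in the recursion does not change the union, which is
  therefore a union of full reachability sets of the chosen minima.\<close>

lemma reached_closed:
  assumes "j \<in> reached \<gamma> k" "(j, i) \<in> \<gamma>\<^sup>*"
  shows "i \<in> reached \<gamma> k"
  using assms
proof (induction k)
  case (Suc k)
  show ?case
  proof (cases "j \<in> reached \<gamma> k")
    case True
    with Suc show ?thesis by (simp add: reached_Suc)
  next
    case False
    then have "j \<in> source_set \<gamma> k" using Suc by (simp add: reached_Suc)
    then have "reached \<gamma> k \<noteq> UNIV" "(Min (UNIV - reached \<gamma> k), j) \<in> \<gamma>\<^sup>*"
      by (auto simp: source_set_reached split: if_splits)
    moreover from this(2) Suc.prems(2) have "(Min (UNIV - reached \<gamma> k), i) \<in> \<gamma>\<^sup>*"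
      by (rule rtrancl_trans)
    ultimately show ?thesis
      by (auto simp: reached_Suc source_set_reached)
  qed
qed (simp add: reached_def)

lemma source_set_disjoint:
  assumes "i \<in> source_set \<gamma> k" "i \<in> source_set \<gamma> l"
  shows "k = l"
proof -
  have "False" if "k < l" "i \<in> source_set \<gamma> k" "i \<in> source_set \<gamma> l" for k l
    using that by (auto simp: source_set_reached[of _ l] reached_def split: if_splits)
  then show ?thesis using assms by (metis linorder_neqE_nat)
qed

lemma Min_unreached:
  assumes "reached \<gamma> k \<noteq> UNIV"
  shows "Min (UNIV - reached \<gamma> k) \<in> source_set \<gamma> k"
proof -
  have "Min (UNIV - reached \<gamma> k) \<in> UNIV - reached \<gamma> k"
    using assms by (intro Min_in) auto
  with assms show ?thesis by (auto simp: source_set_reached)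
qed

lemma source_set_nonempty_iff: "source_set \<gamma> k \<noteq> {} \<longleftrightarrow> reached \<gamma> k \<noteq> UNIV"
  using Min_unreached[of \<gamma> k] by (auto simp: source_set_reached)

text \<open>Each step before exhaustion adds at least the minimum of the remaining vertices, so
  otherwise \<open>reached\<close> would outgrow the finite vertex set.\<close>

lemma reached_eventually_UNIV: "\<exists>k. reached \<gamma> k = UNIV"
proof (rule ccontr)
  assume "\<nexists>k. reached \<gamma> k = UNIV"
  then have "k \<le> card (reached \<gamma> k)" for k
  proof (induction k)
    case (Suc k)
    then have "Min (UNIV - reached \<gamma> k) \<in> source_set \<gamma> k" by (simp add: Min_unreached)
    then have "reached \<gamma> k \<subset> reached \<gamma> (Suc k)"
      by (auto simp: reached_Suc source_set_reached split: if_splits)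
    then have "card (reached \<gamma> k) < card (reached \<gamma> (Suc k))" by (simp add: psubset_card_mono)
    with Suc show ?case by simp
  qed simp
  moreover have "card (reached \<gamma> (Suc CARD('a))) \<le> CARD('a)" by (simp add: card_mono)
  ultimately show False by (meson not_less_eq_eq order_trans)
qed

text \<open>The nonempty source sets are those before the first \<open>N\<close> with
  \<open>reached \<gamma> N = UNIV\<close>, and disjointness keeps them distinct, so
  \<open>N\<close> is their number. This justifies the length chosen in
  \<open>source_partition\<close>.\<close>

lemma source_components_image:
  "source_components \<gamma> = source_set \<gamma> ` {..<card (source_components \<gamma>)}"
  and source_set_nonempty_card: "source_set \<gamma> k \<noteq> {} \<longleftrightarrow> k < card (source_components \<gamma>)"
proof -
  define N where "N = (LEAST k. reached \<gamma> k = UNIV)"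
  have N: "source_set \<gamma> k \<noteq> {} \<longleftrightarrow> k < N" for k
  proof -
    have "reached \<gamma> N = UNIV"
      unfolding N_def using reached_eventually_UNIV by (rule LeastI_ex)
    then have "reached \<gamma> k = UNIV" if "N \<le> k" for k
      using reached_mono[OF that] by blast
    moreover have "reached \<gamma> k \<noteq> UNIV" if "k < N" for k
      using that unfolding N_def by (rule not_less_Least)
    ultimately show ?thesis using source_set_nonempty_iff by (metis not_less)
  qed
  have im: "source_components \<gamma> = source_set \<gamma> ` {..<N}"
    using N by (auto simp: source_components_def)
  have "inj_on (source_set \<gamma>) {..<N}"
  proof (rule inj_onI)
    fix k l assume "k \<in> {..<N}" and eq: "source_set \<gamma> k = source_set \<gamma> l"
    then obtain i where "i \<in> source_set \<gamma> k" using N[of k] by auto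
    then show "k = l" using eq source_set_disjoint[of i \<gamma> k l] by simp
  qed
  then have "card (source_components \<gamma>) = N" by (simp add: im card_image)
  with im N show "source_components \<gamma> = source_set \<gamma> ` {..<card (source_components \<gamma>)}"
    "source_set \<gamma> k \<noteq> {} \<longleftrightarrow> k < card (source_components \<gamma>)" by auto
qed

lemma source_set_cover: "\<exists>k. i \<in> source_set \<gamma> k"
proof -
  obtain k where "reached \<gamma> k = UNIV" using reached_eventually_UNIV by blast
  then have "i \<in> reached \<gamma> k" by simp
  then show ?thesis by (auto simp: reached_def)
qed

lemma partition_on_source_components: "partition_on UNIV (source_components \<gamma>)"
proof (rule partition_onI)
  show "\<Union> (source_components \<gamma>) = UNIV"
    using source_set_cover[of _ \<gamma>] by (fastforce simp: source_components_def)
  show "disjnt B B'" if "B \<in> source_components \<gamma>" "B' \<in> source_components \<gamma>" "B \<noteq> B'" for B B'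
    using that by (auto simp: source_components_def disjnt_def dest: source_set_disjoint)
  show "{} \<notin> source_components \<gamma>"
    by (auto simp: source_components_def)
qed

section \<open>Block indices and block sources\<close>

definition block_index :: "'n::{finite,linorder} rel \<Rightarrow> 'n \<Rightarrow> nat" where
  "block_index \<gamma> i = (THE k. i \<in> source_set \<gamma> k)"

lemma block_index: "i \<in> source_set \<gamma> k \<longleftrightarrow> block_index \<gamma> i = k"
proof -
  have "\<exists>!k. i \<in> source_set \<gamma> k"
    using source_set_cover[of i \<gamma>] source_set_disjoint[of i \<gamma>] by blast
  then have "i \<in> source_set \<gamma> (block_index \<gamma> i)"
    unfolding block_index_def by (rule theI')
  then show ?thesis using source_set_disjoint[of i \<gamma>] by blast
qed

lemma block_index_less: "block_index \<gamma> i < card (source_components \<gamma>)"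
proof -
  have "i \<in> source_set \<gamma> (block_index \<gamma> i)" by (simp add: block_index)
  then show ?thesis using source_set_nonempty_card[of \<gamma> "block_index \<gamma> i"] by auto
qed

text \<open>Once the block of \<open>j\<close> is complete, everything reachable from
  \<open>j\<close> has been collected. Thus arcs, which point to larger coordinates, never lead to a
  later block.\<close>

lemma block_index_antimono:
  assumes "(j, i) \<in> \<gamma>\<^sup>*"
  shows "block_index \<gamma> i \<le> block_index \<gamma> j"
proof -
  \<comment> \<open>\<open>reached \<gamma> k\<close> excludes block \<open>k\<close> itself, hence
    the \<open>Suc\<close>.\<close>
  have "j \<in> reached \<gamma> (Suc (block_index \<gamma> j))"
    by (simp add: reached_Suc block_index)
  then have "i \<in> reached \<gamma> (Suc (block_index \<gamma> j))"
    using assms by (rule reached_closed)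
  then show ?thesis by (auto simp: reached_def block_index)
qed

text \<open>The vertex \<open>m\<close> of the recursion. Past the last block it is the minimum of
  the empty set, hence unspecified; the facts below therefore assume a vertex in block
  \<open>k\<close> or later.\<close>

definition block_source :: "'n::{finite,linorder} rel \<Rightarrow> nat \<Rightarrow> 'n" where
  "block_source \<gamma> k = Min (UNIV - reached \<gamma> k)"

lemma block_source_block_index:
  fixes \<gamma> :: "'n::{finite,linorder} rel"
  assumes "block_index \<gamma> i = k"
  shows "(block_source \<gamma> k, i) \<in> \<gamma>\<^sup>*" and "block_index \<gamma> (block_source \<gamma> k) = k"
proof -
  have i: "i \<in> source_set \<gamma> k" using assms by (simp add: block_index)
  then show "(block_source \<gamma> k, i) \<in> \<gamma>\<^sup>*"
    by (auto simp: block_source_def source_set_reached split: if_splits)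
  show "block_index \<gamma> (block_source \<gamma> k) = k"
    using i Min_unreached[of \<gamma> k] source_set_nonempty_iff[of \<gamma> k]
    by (auto simp: block_source_def block_index)
qed

text \<open>The minimum is taken over everything not yet reached, which includes all later blocks.
  So a source is least in its own block, and sources increase with the block index.\<close>

lemma block_source_le:
  assumes "k \<le> block_index \<gamma> i"
  shows "block_source \<gamma> k \<le> i"
proof -
  have "i \<notin> reached \<gamma> k" using assms by (auto simp: reached_def block_index)
  then show ?thesis by (simp add: block_source_def)
qed

text \<open>Passes from the list of blocks to \<open>block_index\<close>, so that later arguments
  compare numbers rather than list positions.\<close>

lemma partition_points_source_partition:
  "x \<in> partition_points (source_partition \<gamma>) \<longleftrightarrow>
    (\<forall>i j. (block_index \<gamma> i = block_index \<gamma> j \<longrightarrow> x $ i = x $ j) \<and>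
           (block_index \<gamma> i < block_index \<gamma> j \<longrightarrow> x $ j < x $ i))"
  (is "?L \<longleftrightarrow> ?R")
proof
  assume L: ?L
  have nth: "source_partition \<gamma> ! k = source_set \<gamma> k" "source_set \<gamma> k \<in> set (source_partition \<gamma>)"
    if "k < card (source_components \<gamma>)" for k
    using that by (auto simp: source_partition_def)
  have len: "length (source_partition \<gamma>) = card (source_components \<gamma>)"
    by (simp add: source_partition_def)
  have 1: "x $ i = x $ j"
    if "k < card (source_components \<gamma>)" "i \<in> source_set \<gamma> k" "j \<in> source_set \<gamma> k" for i j k
    using L nth(2)[OF that(1)] that(2,3) unfolding partition_points_def by blast
  have 2: "x $ j < x $ i"
    if "k < l" "l < card (source_components \<gamma>)" "i \<in> source_set \<gamma> k" "j \<in> source_set \<gamma> l" for i j k l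
    using L that nth(1)[of k] nth(1)[of l] unfolding partition_points_def len mem_Collect_eq by force
  show ?R
  proof (intro allI conjI impI)
    fix i j
    show "x $ i = x $ j" if "block_index \<gamma> i = block_index \<gamma> j"
      using that by (intro 1[OF block_index_less[of \<gamma> i]]) (simp_all add: block_index)
    show "x $ j < x $ i" if "block_index \<gamma> i < block_index \<gamma> j"
      using that by (rule 2[OF _ block_index_less]) (simp_all add: block_index)
  qed
next
  assume R: ?R
  show ?L
    unfolding partition_points_def
  proof (intro CollectI conjI ballI allI impI; (elim conjE)?)
    fix B i j assume "B \<in> set (source_partition \<gamma>)" "i \<in> B" "j \<in> B"
    then have "block_index \<gamma> i = block_index \<gamma> j"
      by (auto simp: source_partition_def block_index)
    then show "x $ i = x $ j" using R by blast
  next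
    fix a b i j
    assume "a < b" "b < length (source_partition \<gamma>)"
      and "i \<in> source_partition \<gamma> ! a" "j \<in> source_partition \<gamma> ! b"
    then have "block_index \<gamma> i < block_index \<gamma> j"
      by (simp add: source_partition_def block_index)
    then show "x $ j < x $ i" using R by blast
  qed
qed

text \<open>
  A path inside a block starting at its source never leaves the block, since the vertices
  reached earlier are closed under reachability.
\<close>

lemma constant_on_blocks_iff:
  "(\<forall>i j. block_index \<gamma> i = block_index \<gamma> j \<longrightarrow> x $ i = x $ j) \<longleftrightarrow>
   (\<forall>(j, i)\<in>\<gamma>. block_index \<gamma> i = block_index \<gamma> j \<longrightarrow> x $ i = x $ j)" (is "?L \<longleftrightarrow> ?R")
proof
  assume R: ?R
  have src: "x $ i = x $ block_source \<gamma> (block_index \<gamma> i)" for i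
  proof -
    have "block_index \<gamma> i = k \<longrightarrow> x $ i = x $ block_source \<gamma> k"
      if "(block_source \<gamma> k, i) \<in> \<gamma>\<^sup>*" "block_index \<gamma> (block_source \<gamma> k) = k" for k
      using that(1)
    proof induction
      case (step y z)
      show ?case
      proof
        assume z: "block_index \<gamma> z = k"
        have "block_index \<gamma> y = k"
          using block_index_antimono[OF step.hyps(1)] block_index_antimono[OF r_into_rtrancl[OF step.hyps(2)]] z that(2)
          by auto
        then show "x $ z = x $ block_source \<gamma> k" using step R z by fastforce
      qed
    qed simp
    then show ?thesis using block_source_block_index[OF refl] by blast
  qed
  show ?L
  proof (intro allI impI)
    fix i j assume "block_index \<gamma> i = block_index \<gamma> j"
    then show "x $ i = x $ j" using src[of i] src[of j] by simp
  qed
qed blast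

section \<open>Growth of \<open>v\<close> and its projection onto an order cone\<close>

text \<open>Induction on the number of larger elements passes through the immediate successor;
  positivity and \<open>c \<ge> 1\<close> carry the inequality past it.\<close>

lemma gap_propagates:
  fixes f :: "'n::{finite,linorder} \<Rightarrow> real"
  assumes step: "\<And>i j. i < j \<Longrightarrow> \<not> (\<exists>l. i < l \<and> l < j) \<Longrightarrow> f i > c * f j"
    and last: "f (Max UNIV) > 0" and c: "c \<ge> 1"
  shows "f i > 0" and "i < j \<Longrightarrow> f i > c * f j"
proof -
  have "f i > 0 \<and> (\<forall>j>i. f i > c * f j)"
  proof (induction "card {i<..}" arbitrary: i rule: less_induct)
    case less
    show ?case
    proof (cases "{i<..} = {}")
      case True
      then have "i = Max UNIV"
        by (metis Max_ge Max_in UNIV_I UNIV_not_empty finite greaterThan_iff empty_iff order_less_le)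
      with True last show ?thesis by auto
    next
      case False
      define s where "s = Min {i<..}"
      have s: "i < s" using Min_in[OF _ False] by (simp add: s_def)
      have smin: "s \<le> j" if "i < j" for j using that by (simp add: s_def)
      have "card {s<..} < card {i<..}"
        using s by (intro psubset_card_mono) auto
      from less[OF this] have IH: "f s > 0" "\<And>j. s < j \<Longrightarrow> f s > c * f j" by auto
      have fs: "f i > c * f s" using step[of i s] s smin by (meson not_less)
      have cs: "c * f s \<ge> f s" using c IH(1) by simp
      have "f i > c * f j" if "i < j" for j
        using smin[OF that] fs cs IH(2)[of j] by (cases "j = s") (auto simp: less_le)
      moreover have "f i > 0" using fs cs IH(1) by linarith
      ultimately show ?thesis by blast
    qed
  qed
  then show "f i > 0" "i < j \<Longrightarrow> f i > c * f j" by auto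
qed

text \<open>Expanding the squared norm of \<open>v - y\<close> about \<open>p\<close> leaves that of
  \<open>v - p\<close>, a nonnegative cross term and a square.\<close>

lemma closest_point_variational:
  fixes S :: "'a::euclidean_space set"
  assumes "closed S" "convex S" "p \<in> S" "\<And>y. y \<in> S \<Longrightarrow> (v - p) \<bullet> (y - p) \<le> 0"
  shows "closest_point S v = p"
proof (rule closest_point_unique[symmetric, OF assms(2,1,3)], rule ballI)
  fix y assume "y \<in> S"
  then have "(v - p) \<bullet> (y - p) \<le> 0" by (rule assms(4))
  moreover have "(norm (v - y))\<^sup>2 = (norm (v - p))\<^sup>2 - 2 * ((v - p) \<bullet> (y - p)) + (norm (y - p))\<^sup>2"
    unfolding power2_norm_eq_inner by (simp add: algebra_simps inner_commute)
  ultimately have "(norm (v - p))\<^sup>2 \<le> (norm (v - y))\<^sup>2" by (smt (verit) zero_le_power2)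
  then show "dist v p \<le> dist v y" by (simp add: dist_norm)
qed

text \<open>The orthogonal projection of \<open>v\<close> onto the vectors constant on each
  block.\<close>

definition block_average :: "'n::{finite,linorder} rel \<Rightarrow> real^'n::{finite,linorder} \<Rightarrow> real^'n::{finite,linorder}" where
  "block_average \<gamma> v = (\<chi> i. let S = source_set \<gamma> (block_index \<gamma> i) in (\<Sum>j\<in>S. v $ j) / real (card S))"

lemma sum_block_average:
  "(\<Sum>i\<in>source_set \<gamma> k. v $ i - block_average \<gamma> v $ i) = 0"
proof (cases "source_set \<gamma> k = {}")
  case False
  have "(\<Sum>i\<in>source_set \<gamma> k. block_average \<gamma> v $ i) =
      (\<Sum>i\<in>source_set \<gamma> k. (\<Sum>j\<in>source_set \<gamma> k. v $ j) / real (card (source_set \<gamma> k)))"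
    by (intro sum.cong) (auto simp: block_average_def Let_def block_index)
  also have "\<dots> = (\<Sum>j\<in>source_set \<gamma> k. v $ j)" using False by simp
  finally show ?thesis by (simp add: sum_subtractf)
qed simp

text \<open>A block has at most \<open>CARD('n)\<close> entries, all positive, so its average is at
  least the source entry over \<open>CARD('n)\<close>. The source is the least index of the block,
  so its entry is the largest and bounds the average from above.\<close>

lemma block_average_bounds:
  fixes v :: "real^'n::{finite,linorder}"
  assumes pos: "\<And>i. v $ i > 0" and gap: "\<And>i j. i < j \<Longrightarrow> v $ i > real CARD('n) * v $ j"
    and "block_index \<gamma> i = k"
  shows "v $ block_source \<gamma> k / real CARD('n) \<le> block_average \<gamma> v $ i"
    and "block_average \<gamma> v $ i \<le> v $ block_source \<gamma> k"
proof -
  let ?S = "source_set \<gamma> k" and ?m = "block_source \<gamma> k"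
  have m: "?m \<in> ?S" using block_source_block_index[OF assms(3)] by (simp add: block_index)
  have eq: "block_average \<gamma> v $ i = (\<Sum>j\<in>?S. v $ j) / real (card ?S)"
    by (simp add: block_average_def Let_def assms(3))
  have card: "0 < card ?S" "card ?S \<le> CARD('n)" using m by (auto simp: card_gt_0_iff intro: card_mono)
  have "v $ ?m / real CARD('n) \<le> v $ ?m / real (card ?S)"
    using card pos[of ?m] by (intro divide_left_mono) auto
  also have "\<dots> \<le> (\<Sum>j\<in>?S. v $ j) / real (card ?S)"
    using m pos by (intro divide_right_mono member_le_sum) (auto intro: less_imp_le)
  finally show "v $ ?m / real CARD('n) \<le> block_average \<gamma> v $ i" by (simp add: eq)
  have "v $ j \<le> v $ ?m" if "j \<in> ?S" for j
  proof (cases "j = ?m")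
    case False
    have "?m \<le> j" using that by (intro block_source_le) (simp add: block_index)
    with False have "real CARD('n) * v $ j < v $ ?m" using gap[of ?m j] by simp
    moreover have "1 * v $ j \<le> real CARD('n) * v $ j"
      using pos[of j] by (intro mult_right_mono) (auto simp: Suc_le_eq)
    ultimately show ?thesis by simp
  qed simp
  then have "(\<Sum>j\<in>?S. v $ j) \<le> real (card ?S) * v $ ?m"
    using sum_bounded_above[of ?S "\<lambda>j. v $ j"] by simp
  then show "block_average \<gamma> v $ i \<le> v $ ?m"
    using card by (simp add: eq field_simps)
qed

text \<open>Sources increase with the block index, so the gap condition puts the later source entry
  below the earlier one divided by \<open>CARD('n)\<close>; the two average bounds sit on either
  side of this gap.\<close>

lemma block_average_in_partition_points:
  fixes v :: "real^'n::{finite,linorder}"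
  assumes pos: "\<And>i. v $ i > 0" and gap: "\<And>i j. i < j \<Longrightarrow> v $ i > real CARD('n) * v $ j"
  shows "block_average \<gamma> v \<in> partition_points (source_partition \<gamma>)"
  unfolding partition_points_source_partition
proof (intro allI conjI impI)
  fix i j
  show "block_average \<gamma> v $ i = block_average \<gamma> v $ j" if "block_index \<gamma> i = block_index \<gamma> j"
    using that by (simp add: block_average_def)
  assume less: "block_index \<gamma> i < block_index \<gamma> j"
  let ?m = "block_source \<gamma> (block_index \<gamma> i)" and ?m' = "block_source \<gamma> (block_index \<gamma> j)"
  have idx: "block_index \<gamma> ?m = block_index \<gamma> i" "block_index \<gamma> ?m' = block_index \<gamma> j"
    by (simp_all add: block_source_block_index)
  then have "?m \<le> ?m'" using less by (intro block_source_le) simp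
  moreover have "?m \<noteq> ?m'" using idx less by auto
  ultimately have "real CARD('n) * v $ ?m' < v $ ?m" using gap by simp
  then have "v $ ?m' < v $ ?m / real CARD('n)" by (simp add: field_simps)
  then show "block_average \<gamma> v $ j < block_average \<gamma> v $ i"
    using block_average_bounds(1)[OF pos gap refl, of \<gamma> i]
      block_average_bounds(2)[OF pos gap refl, of \<gamma> j] by linarith
qed

lemma partition_points_subset_order_cone:
  "partition_points (source_partition \<gamma>) \<subseteq> order_cone \<gamma>"
proof
  fix x assume x: "x \<in> partition_points (source_partition \<gamma>)"
  have "x $ j \<le> x $ i" if "(j, i) \<in> \<gamma>" for i j
    using block_index_antimono[OF r_into_rtrancl[OF that]]
      x[unfolded partition_points_source_partition, rule_format, of i j]
    by linarith
  then show "x \<in> order_cone \<gamma>" by (auto simp: order_cone_def)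
qed

text \<open>
  Within a block, only the source has an entry of \<open>v\<close> above the average, and every point of the
  cone takes its minimum over the block there.
\<close>

lemma closest_point_order_cone:
  fixes v :: "real^'n::{finite,linorder}"
  assumes pos: "\<And>i. v $ i > 0" and gap: "\<And>i j. i < j \<Longrightarrow> v $ i > real CARD('n) * v $ j"
  shows "closest_point (order_cone \<gamma>) v = block_average \<gamma> v"
proof (rule closest_point_variational[OF closed_order_cone convex_order_cone])
  let ?p = "block_average \<gamma> v" and ?N = "card (source_components \<gamma>)"
  show "?p \<in> order_cone \<gamma>"
    using block_average_in_partition_points[OF pos gap] partition_points_subset_order_cone by blast
  fix y assume y: "y \<in> order_cone \<gamma>"
  have block: "(\<Sum>i\<in>source_set \<gamma> k. (v $ i - ?p $ i) * (y $ i - ?p $ i)) \<le> 0" for k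
  proof -
    let ?m = "block_source \<gamma> k"
    \<comment> \<open>The difference \<open>y - ?p\<close> is split at the source: the second part
      is constant on the block and drops out because the residuals \<open>v - ?p\<close> sum to zero
      there.\<close>
    have "(\<Sum>i\<in>source_set \<gamma> k. (v $ i - ?p $ i) * (y $ i - ?p $ i)) =
        (\<Sum>i\<in>source_set \<gamma> k. (v $ i - ?p $ i) * (y $ i - y $ ?m) + (v $ i - ?p $ i) * (y $ ?m - ?p $ ?m))"
    proof (rule sum.cong)
      fix i assume "i \<in> source_set \<gamma> k"
      then have "?p $ i = ?p $ ?m"
        by (simp add: block_average_def block_index block_source_block_index)
      then show "(v $ i - ?p $ i) * (y $ i - ?p $ i) =
          (v $ i - ?p $ i) * (y $ i - y $ ?m) + (v $ i - ?p $ i) * (y $ ?m - ?p $ ?m)"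
        by (simp add: algebra_simps)
    qed simp
    also have "\<dots> = (\<Sum>i\<in>source_set \<gamma> k. (v $ i - ?p $ i) * (y $ i - y $ ?m))"
      by (simp add: sum.distrib sum_distrib_right[symmetric] sum_block_average)
    also have "\<dots> \<le> 0"
    proof (rule sum_nonpos)
      fix i assume "i \<in> source_set \<gamma> k"
      then have i: "block_index \<gamma> i = k" by (simp add: block_index)
      show "(v $ i - ?p $ i) * (y $ i - y $ ?m) \<le> 0"
      \<comment> \<open>At the source the residual may be positive, but its factor is zero.\<close>
      proof (cases "i = ?m")
        case False
        then have "?m < i" using block_source_le[of k \<gamma> i] i by simp
        then have "v $ i < v $ ?m / real CARD('n)" using gap by (simp add: field_simps)
        then have "v $ i - ?p $ i \<le> 0"
          using block_average_bounds(1)[OF pos gap i] by simp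
        moreover have "y $ ?m \<le> y $ i"
          using order_cone_rtrancl[OF y block_source_block_index(1)[OF i]] .
        ultimately show ?thesis by (simp add: mult_nonpos_nonneg)
      qed simp
    qed
    finally show ?thesis .
  qed
  have "(v - ?p) \<bullet> (y - ?p) = (\<Sum>i\<in>(\<Union>k<?N. source_set \<gamma> k). (v $ i - ?p $ i) * (y $ i - ?p $ i))"
  proof -
    have "(\<Union>k<?N. source_set \<gamma> k) = UNIV"
      by (auto simp: block_index block_index_less)
    then show ?thesis by (simp add: inner_vec_def)
  qed
  also have "\<dots> = (\<Sum>k<?N. \<Sum>i\<in>source_set \<gamma> k. (v $ i - ?p $ i) * (y $ i - ?p $ i))"
    by (rule sum.UNION_disjoint) (auto dest: source_set_disjoint)
  also have "\<dots> \<le> 0" by (rule sum_nonpos) (rule block)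
  finally show "(v - ?p) \<bullet> (y - ?p) \<le> 0" .
qed

section \<open>The face containing the projection, and its dimension\<close>

text \<open>On these points the weak order of two coordinates is the reverse of that of their block
  indices, and a cell depends only on the order of the coordinates of its point.\<close>

lemma cell_eq_of_partition_points:
  assumes "x \<in> partition_points (source_partition \<gamma>)" "y \<in> partition_points (source_partition \<gamma>)"
  shows "cell E x = cell E y"
proof -
  have "x $ j \<le> x $ i \<longleftrightarrow> block_index \<gamma> i \<le> block_index \<gamma> j"
    if "x \<in> partition_points (source_partition \<gamma>)" for x i j
    using that[unfolded partition_points_source_partition, rule_format, of i j]
      that[unfolded partition_points_source_partition, rule_format, of j i]
    by (cases "block_index \<gamma> i" "block_index \<gamma> j" rule: linorder_cases) auto
  with assms show ?thesis by (simp add: cell_def)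
qed

text \<open>Ties of \<open>p\<close> on edges are the edges within a block. Paths from the source
  join each block internally, so equality along these edges means being constant on blocks, a space
  with one dimension per block.\<close>

lemma aff_dim_cell_partition_point:
  fixes p :: "real^'n::{finite,linorder}"
  assumes R: "region (graphical_arrangement E) R"
    and p: "p \<in> partition_points (source_partition (region_orientation E R))"
  shows "aff_dim (cell E p) = int (card (source_components (region_orientation E R)))"
proof -
  let ?\<gamma> = "region_orientation E R"
  have eqp: "p $ i = p $ j \<longleftrightarrow> block_index ?\<gamma> i = block_index ?\<gamma> j" for i j
    using p[unfolded partition_points_source_partition, rule_format, of i j]
      p[unfolded partition_points_source_partition, rule_format, of j i]
    by (cases "block_index ?\<gamma> i" "block_index ?\<gamma> j" rule: linorder_cases) auto
  have "(\<forall>i j. {i, j} \<in> E \<and> p $ i = p $ j \<longrightarrow> x $ i = x $ j) \<longleftrightarrow>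
      (\<forall>B\<in>source_components ?\<gamma>. \<forall>i\<in>B. \<forall>j\<in>B. x $ i = x $ j)" for x :: "real^'n::{finite,linorder}"
  proof -
    have "(\<forall>i j. {i, j} \<in> E \<and> p $ i = p $ j \<longrightarrow> x $ i = x $ j) \<longleftrightarrow>
        (\<forall>(j, i)\<in>?\<gamma>. block_index ?\<gamma> i = block_index ?\<gamma> j \<longrightarrow> x $ i = x $ j)"
    proof -
      have edge: "{i, j} \<in> E \<longleftrightarrow> (i, j) \<in> ?\<gamma> \<or> (j, i) \<in> ?\<gamma>" for i j
        using region_eq_order_cone(2)[OF R, of i j] by (auto simp: region_orientation_def insert_commute)
      show ?thesis
        unfolding eqp
      proof (intro iffI allI ballI impI; clarify?)
        fix i j
        assume "\<forall>i j. {i, j} \<in> E \<and> block_index ?\<gamma> i = block_index ?\<gamma> j \<longrightarrow> x $ i = x $ j"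
          and "(j, i) \<in> ?\<gamma>" "block_index ?\<gamma> i = block_index ?\<gamma> j"
        then show "x $ i = x $ j" using edge[of i j] by blast
      next
        fix i j
        assume const: "\<forall>(j, i)\<in>?\<gamma>. block_index ?\<gamma> i = block_index ?\<gamma> j \<longrightarrow> x $ i = x $ j"
          and "{i, j} \<in> E" and eq: "block_index ?\<gamma> i = block_index ?\<gamma> j"
        then consider "(i, j) \<in> ?\<gamma>" | "(j, i) \<in> ?\<gamma>" using edge by blast
        then show "x $ i = x $ j"
          by cases (use bspec[OF const] eq in fastforce)+
      qed
    qed
    also have "\<dots> \<longleftrightarrow> (\<forall>i j. block_index ?\<gamma> i = block_index ?\<gamma> j \<longrightarrow> x $ i = x $ j)"
      by (simp only: constant_on_blocks_iff)
    also have "\<dots> \<longleftrightarrow> (\<forall>B\<in>source_components ?\<gamma>. \<forall>i\<in>B. \<forall>j\<in>B. x $ i = x $ j)"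
    proof -
      have "block_index ?\<gamma> i = block_index ?\<gamma> j \<longleftrightarrow> (\<exists>B\<in>source_components ?\<gamma>. i \<in> B \<and> j \<in> B)" for i j
      proof
        assume eq: "block_index ?\<gamma> i = block_index ?\<gamma> j"
        have "i \<in> source_set ?\<gamma> (block_index ?\<gamma> i)" "j \<in> source_set ?\<gamma> (block_index ?\<gamma> i)"
          by (simp_all add: block_index eq)
        then show "\<exists>B\<in>source_components ?\<gamma>. i \<in> B \<and> j \<in> B"
          unfolding source_components_def by blast
      qed (auto simp: source_components_def block_index)
      then show ?thesis by blast
    qed
    finally show ?thesis .
  qed
  then have "{x::real^'n::{finite,linorder}. \<forall>i j. {i, j} \<in> E \<and> p $ i = p $ j \<longrightarrow> x $ i = x $ j} =
      {x. \<forall>B\<in>source_components ?\<gamma>. \<forall>i\<in>B. \<forall>j\<in>B. x $ i = x $ j}"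
    by (intro Collect_cong)
  then show ?thesis
    using cell_aff(2)[of E p] dim_partition_constant[OF partition_on_source_components, of ?\<gamma>]
    by simp
qed

theorem theorem4p4:
  fixes v :: "real^'n::{finite,linorder}"
    and E :: "'n set set"
    and R :: "(real^'n::{finite,linorder}) set"
    and k :: nat
  assumes "\<And>i j. i < j \<Longrightarrow> \<not> (\<exists>l. i < l \<and> l < j) \<Longrightarrow>
             v $ i > (6 * (real CARD('n))\<^sup>2 + 1) * v $ j"
    and "v $ Max UNIV > 0"
    and "simple_graph E"
    and "region (graphical_arrangement E) R"
    and "card (source_components (region_orientation E R)) = k"
  shows "proj_dim v R = int k \<and>
         proj_face v R = partition_face E (source_partition (region_orientation E R))"
proof -
  let ?\<gamma> = "region_orientation E R" and ?A = "graphical_arrangement E"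
  define c where "c = 6 * (real CARD('n))\<^sup>2 + 1"
  \<comment> \<open>Makes \<open>c\<close> dominate \<open>CARD('n)\<close>, the ratio in which the
    projection lemmas are stated.\<close>
  have "real CARD('n) \<le> (real CARD('n))\<^sup>2" by (simp add: power2_eq_square)
  then have cn: "real CARD('n) \<le> c" "1 \<le> c"
    unfolding c_def using zero_le_power2[of "real CARD('n)"] by linarith+
  have pos: "v $ i > 0" for i
    using gap_propagates(1)[of c "($) v"] assms(1,2) cn(2) by (simp add: c_def)
  have gap: "v $ i > real CARD('n) * v $ j" if "i < j" for i j
  proof -
    have "v $ i > c * v $ j"
      using gap_propagates(2)[of c "($) v"] assms(1,2) cn(2) that by (simp add: c_def)
    moreover have "real CARD('n) * v $ j \<le> c * v $ j"
      using cn(1) pos[of j] by (intro mult_right_mono) auto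
    ultimately show ?thesis by simp
  qed
  note R = \<open>region ?A R\<close>
  note RK = region_eq_order_cone(1)[OF R]
  define p where "p = block_average ?\<gamma> v"
  have p: "p \<in> partition_points (source_partition ?\<gamma>)"
    unfolding p_def by (rule block_average_in_partition_points[OF pos gap])
  have pR: "p \<in> R" using p partition_points_subset_order_cone RK by blast
  have proj: "proj_point v R = p"
    using closest_point_order_cone[OF pos gap, of ?\<gamma>] RK by (simp add: proj_point_def p_def)
  have face: "cell E p face_of R" using R pR by (rule cell_face_of_region)
  have proj_face: "proj_face v R = cell E p"
    unfolding proj_face_def proj
    by (rule the_equality) (use face cell_aff(1) region_face_eq_cell[OF R] in auto)
  moreover have "partition_face E (source_partition ?\<gamma>) = cell E p"
    unfolding partition_face_def
  proof (rule the_equality)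
    \<comment> \<open>All partition points share the cell of \<open>p\<close>, and each lies in the
      relative interior of its own cell.\<close>
    have "q \<in> rel_interior (cell E p)" if "q \<in> partition_points (source_partition ?\<gamma>)" for q
      using cell_aff(1)[of q E] cell_eq_of_partition_points[OF that p] by simp
    moreover have "arrangement_face ?A (cell E p)"
      using R face mem_cell_self[of p E] by (auto simp: arrangement_face_def)
    ultimately show "arrangement_face ?A (cell E p) \<and>
        partition_points (source_partition ?\<gamma>) \<subseteq> rel_interior (cell E p)" by blast
    \<comment> \<open>A competing face may belong to another region \<open>R'\<close>. Its relative
      interior still contains the partition point \<open>p\<close>, whose cell is the same for every
      region.\<close>
    show "F = cell E p" if "arrangement_face ?A F \<and>
        partition_points (source_partition ?\<gamma>) \<subseteq> rel_interior F" for F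
    proof -
      from that obtain R' where "region ?A R'" "F face_of R'" "p \<in> rel_interior F"
        using p by (auto simp: arrangement_face_def)
      then show ?thesis by (rule region_face_eq_cell)
    qed
  qed
  ultimately show ?thesis
    using aff_dim_cell_partition_point[OF R p] assms(5) by (simp add: proj_dim_def)
qed

end
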